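(* For all probabilistic process terms $e,f\in\mathsf{PTerm}$: $\operatorname{trm}(e)=\operatorname{trm}(f)$ if and only if for every nonempty complete metric space $(M,d)$ and every contraction operator interpretation $\sigma:A\to\operatorname{Con}(M,d)$, $\hat\delta_\sigma(e)=\hat\delta_\sigma(f)$.
   Context: $A$ is a fixed finite set of actions. Probabilistic terms over countably many variables: $e::= v\mid ae\mid e_1\oplus_r e_2\mid\mu v\,e$ with $a\in A$, $r\in[0,1]$. $\mathsf{PTerm}$ is the set of closed (each occurrence of $v$ in the scope of $\mu v$) and guarded (each such occurrence, inside its binder, within a prefix $a(-)$) probabilistic terms; $e[g/v]$ is capture-avoiding substitution. The syntactic LMC $\delta:\mathsf{PTerm}\to\mathcal D(A\times\mathsf{PTerm})$ ($\mathcal D$ = finitely supported probability distributions) is given by $\delta(ae)(b,f)=1$ if $b=a$ and $f=e$, else $0$; $\delta(e_1\oplus_r e_2)(b,f)=r\,\delta(e_1)(b,f)+(1-r)\,\delta(e_2)(b,f)$; $\delta(\mu v\,e)=\delta(e[\mu v\,e/v])$. Write $e\xrightarrow{r\mid a}e'$ when $\delta(e)(a,e')=r$. $A^\omega$ has basic open sets $B_w$ (streams with prefix $w\in A^*$). $\operatorname{trm}(e)$ is the unique Borel probability measure on $A^\omega$ with $\operatorname{trm}(e)(B_{a_1\cdots a_n})=\sum\{r_1\cdots r_n: e\xrightarrow{r_1\mid a_1}e_1\cdots\xrightarrow{r_n\mid a_n}e_n\}$ and $\operatorname{trm}(e)(A^\omega)=1$. For $\sigma:A\to\operatorname{Con}(M,d)$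 (contractions), $\sigma_\omega(a_1,\dots)=\lim_n\sigma_{a_1}\cdots\sigma_{a_n}(p)$ ($p$ arbitrary), and $\hat\delta_\sigma(e)=\sigma_\omega^\#\operatorname{trm}(e)$, the pushforward Borel probability measure on $M$ ($\sigma_\omega^\#\rho(B)=\rho(\sigma_\omega^{-1}(B))$). *)

theory Defs
  imports "HOL-Probability.Probability" "HOL-Library.Stream"
begin

section \<open>Probabilistic process terms\<close>

typedef prob = "{0..1 :: real}"
  morphisms real_of_prob Prob
  by (rule exI[of _ 0]) simp

text \<open>Variables are names in the type of natural numbers; terms are not identified up to
  renaming of bound variables.\<close>

datatype 'a pterm =
    Var nat
  | Pre 'a "'a pterm"
  | Choice prob "'a pterm" "'a pterm"
  | Mu nat "'a pterm"

primrec fv :: "'a pterm \<Rightarrow> nat set" where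
  "fv (Var v) = {v}"
| "fv (Pre a e) = fv e"
| "fv (Choice r e1 e2) = fv e1 \<union> fv e2"
| "fv (Mu v e) = fv e - {v}"

text \<open>Variables with a free occurrence that is not within a prefix.\<close>

primrec ufv :: "'a pterm \<Rightarrow> nat set" where
  "ufv (Var v) = {v}"
| "ufv (Pre a e) = {}"
| "ufv (Choice r e1 e2) = ufv e1 \<union> ufv e2"
| "ufv (Mu v e) = ufv e - {v}"

primrec guarded :: "'a pterm \<Rightarrow> bool" where
  "guarded (Var v) \<longleftrightarrow> True"
| "guarded (Pre a e) \<longleftrightarrow> guarded e"
| "guarded (Choice r e1 e2) \<longleftrightarrow> guarded e1 \<and> guarded e2"
| "guarded (Mu v e) \<longleftrightarrow> guarded e \<and> v \<notin> ufv e"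

definition PTerm :: "'a pterm set" where
  "PTerm = {e. fv e = {} \<and> guarded e}"

text \<open>Simultaneous substitution. A bound variable is renamed, to a fresh one, only if it
  would capture a free variable of one of the substituted terms.\<close>

primrec subst :: "(nat \<Rightarrow> 'a pterm) \<Rightarrow> 'a pterm \<Rightarrow> 'a pterm" where
  "subst s (Var v) = s v"
| "subst s (Pre a e) = Pre a (subst s e)"
| "subst s (Choice r e1 e2) = Choice r (subst s e1) (subst s e2)"
| "subst s (Mu v e) =
    (let V = (\<Union>x \<in> fv (Mu v e). fv (s x));
         u = (if v \<in> V then LEAST u. u \<notin> V else v)
     in Mu u (subst (s(v := Var u)) e))"

definition subst1 :: "'a pterm \<Rightarrow> 'a pterm \<Rightarrow> nat \<Rightarrow> 'a pterm" ("_[_'/_]" [1000, 0, 0] 1000) where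
  "e[g/v] = subst (Var(v := g)) e"


section \<open>The syntactic labelled Markov chain\<close>

text \<open>The number of operators above the prefixes; it decreases along the recursion that
  defines the transition distribution.\<close>

primrec unguarded_size :: "'a pterm \<Rightarrow> nat" where
  "unguarded_size (Var v) = 0"
| "unguarded_size (Pre a e) = 0"
| "unguarded_size (Choice r e1 e2) = Suc (unguarded_size e1 + unguarded_size e2)"
| "unguarded_size (Mu v e) = Suc (unguarded_size e)"

lemma unguarded_size_subst:
  "(\<And>x. x \<in> ufv e \<Longrightarrow> unguarded_size (s x) = 0) \<Longrightarrow> unguarded_size (subst s e) = unguarded_size e"
  by (induction e arbitrary: s) (auto simp: Let_def)

text \<open>Outside of the closed and guarded terms the value is immaterial.\<close>

function delta :: "'a pterm \<Rightarrow> ('a \<times> 'a pterm) pmf" where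
  "delta (Var v) = undefined"
| "delta (Pre a e) = return_pmf (a, e)"
| "delta (Choice r e1 e2) =
    bind_pmf (bernoulli_pmf (real_of_prob r)) (\<lambda>b. if b then delta e1 else delta e2)"
| "delta (Mu v e) = (if v \<in> ufv e then undefined else delta (e[Mu v e/v]))"
  by pat_completeness auto
termination
proof (relation "Wellfounded.measure unguarded_size")
  fix v and e :: "'a pterm"
  assume "v \<notin> ufv e"
  then have "unguarded_size (e[Mu v e/v]) = unguarded_size e"
    unfolding subst1_def by (intro unguarded_size_subst) auto
  then show "(e[Mu v e/v], Mu v e) \<in> Wellfounded.measure unguarded_size"
    by simp
qed auto

lemma pmf_delta_Pre:
  "pmf (delta (Pre a e)) (b, f) = (if b = a \<and> f = e then 1 else 0)"
  by (auto simp: pmf_return indicator_def)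

lemma pmf_delta_Choice:
  "pmf (delta (Choice r e1 e2)) (b, f) =
    real_of_prob r * pmf (delta e1) (b, f) + (1 - real_of_prob r) * pmf (delta e2) (b, f)"
  using real_of_prob[of r] by (simp add: pmf_bind)

lemma delta_Mu:
  "Mu v e \<in> PTerm \<Longrightarrow> delta (Mu v e) = delta (e[Mu v e/v])"
  by (simp add: PTerm_def)

lemma finite_fv: "finite (fv e)"
  by (induction e) auto

lemma fv_ufv: "ufv e \<subseteq> fv e"
  by (induction e) auto

lemma fresh_for_subst:
  assumes "\<And>x. x \<in> fv e - {v} \<Longrightarrow> finite (fv (s x))"
  defines "V \<equiv> (\<Union>x \<in> fv e - {v}. fv (s x))"
  shows "(if v \<in> V then LEAST u. u \<notin> V else v) \<notin> V"
proof -
  have "finite V"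
    using assms(1) finite_fv[of e] unfolding V_def by blast
  then have "\<exists>u. u \<notin> V"
    using ex_new_if_finite[OF infinite_UNIV_nat] by blast
  then have "(LEAST u. u \<notin> V) \<notin> V"
    by (rule LeastI_ex)
  then show ?thesis by simp
qed

lemma fv_subst: "fv (subst s e) = (\<Union>x \<in> fv e. fv (s x))"
proof (induction e arbitrary: s)
  case (Mu v e)
  show ?case
    using fresh_for_subst[of e v s] finite_fv
    by (auto simp: Let_def Mu.IH split: if_splits)
qed auto

lemma ufv_subst: "ufv (subst s e) \<subseteq> (\<Union>x \<in> ufv e. fv (s x))"
proof (induction e arbitrary: s)
  case (Var v)
  show ?case using fv_ufv by auto
next
  case (Choice r e1 e2)
  show ?case using Choice.IH[of s] by auto
next
  case (Mu v e)
  show ?case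
    unfolding subst.simps Let_def ufv.simps
    using Mu.IH by (fastforce split: if_splits)
qed simp

lemma guarded_subst:
  "guarded e \<Longrightarrow> (\<And>x. guarded (s x)) \<Longrightarrow> guarded (subst s e)"
proof (induction e arbitrary: s)
  case (Mu v e)
  let ?V = "\<Union>x \<in> fv e - {v}. fv (s x)"
  define u where "u = (if v \<in> ?V then LEAST u. u \<notin> ?V else v)"
  have u: "u \<notin> ?V"
    using fresh_for_subst[of e v s] finite_fv unfolding u_def by blast
  have "u \<notin> ufv (subst (s(v := Var u)) e)"
  proof
    assume "u \<in> ufv (subst (s(v := Var u)) e)"
    then obtain x where "x \<in> ufv e" "u \<in> fv ((s(v := Var u)) x)"
      using ufv_subst by blast
    with Mu.prems(1) u fv_ufv[of e] show False
      by (auto split: if_splits)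
  qed
  moreover have "guarded (subst (s(v := Var u)) e)"
    using Mu.prems by (intro Mu.IH) auto
  moreover have "subst s (Mu v e) = Mu u (subst (s(v := Var u)) e)"
    by (simp add: u_def Let_def)
  ultimately show ?case by simp
qed auto

lemma PTerm_unfold: "Mu v e \<in> PTerm \<Longrightarrow> e[Mu v e/v] \<in> PTerm"
  by (auto simp: PTerm_def subst1_def fv_subst intro!: guarded_subst)

lemma delta_PTerm:
  "e \<in> PTerm \<Longrightarrow> finite (set_pmf (delta e)) \<and> set_pmf (delta e) \<subseteq> UNIV \<times> PTerm"
proof (induction e rule: delta.induct)
  case (3 r e1 e2)
  have "e1 \<in> PTerm" "e2 \<in> PTerm"
    using "3.prems" by (simp_all add: PTerm_def)
  then have "finite (set_pmf (if b then delta e1 else delta e2)) \<and>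
      set_pmf (if b then delta e1 else delta e2) \<subseteq> UNIV \<times> PTerm"
    if "b \<in> set_pmf (bernoulli_pmf (real_of_prob r))" for b
    using "3.IH" that by (cases b) auto
  moreover have "set_pmf (delta (Choice r e1 e2)) =
      (\<Union>b \<in> set_pmf (bernoulli_pmf (real_of_prob r)).
        set_pmf (if b then delta e1 else delta e2))"
    by simp
  ultimately show ?case
    by (auto intro!: finite_UN_I simp del: delta.simps)
next
  case (4 v e)
  then show ?case
    using PTerm_unfold[of v e] by (simp add: PTerm_def)
qed (auto simp: PTerm_def)


section \<open>Borel sets of a topology\<close>

definition borel_of :: "'b topology \<Rightarrow> 'b measure" where
  "borel_of X = sigma (topspace X) {U. openin X U}"


section \<open>Trace measures\<close>

definition cylinder :: "'a list \<Rightarrow> 'a stream set" where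
  "cylinder w = {s. stake (length w) s = w}"

definition stream_topology :: "'a stream topology" where
  "stream_topology = topology_generated_by (range cylinder)"

text \<open>The product of the probabilities along the transitions from \<open>e\<close> through the
  successive states \<open>es\<close>, labelled by the letters of \<open>w\<close>.\<close>

definition path_weight :: "'a pterm \<Rightarrow> 'a list \<Rightarrow> 'a pterm list \<Rightarrow> real" where
  "path_weight e w es = (\<Prod>i<length w. pmf (delta ((e # es) ! i)) (w ! i, es ! i))"

text \<open>Only finitely many paths have nonzero weight (lemma \<open>finite_paths\<close>).\<close>

definition word_prob :: "'a pterm \<Rightarrow> 'a list \<Rightarrow> real" where
  "word_prob e w = (\<Sum>es | length es = length w \<and> path_weight e w es \<noteq> 0. path_weight e w es)"

lemma finite_paths:
  "e \<in> PTerm \<Longrightarrow> finite {es. length es = length w \<and> path_weight e w es \<noteq> 0}"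
proof (induction w arbitrary: e)
  case Nil
  show ?case
    by (rule finite_subset[of _ "{[]}"]) auto
next
  case (Cons a w)
  let ?S = "snd ` set_pmf (delta e)"
  have "path_weight e (a # w) (e' # es) = pmf (delta e) (a, e') * path_weight e' w es" for e' es
    by (simp add: path_weight_def prod.lessThan_Suc_shift del: prod.lessThan_Suc)
  then have "{es. length es = length (a # w) \<and> path_weight e (a # w) es \<noteq> 0}
      \<subseteq> (\<Union>e' \<in> ?S. (#) e' ` {es. length es = length w \<and> path_weight e' w es \<noteq> 0})"
    by (force simp: length_Suc_conv set_pmf_iff)
  moreover have "finite \<dots>"
    using delta_PTerm[OF Cons.prems] by (intro finite_UN_I finite_imageI Cons.IH) auto
  ultimately show ?case
    by (rule finite_subset)
qed

definition trm :: "'a pterm \<Rightarrow> 'a stream measure" where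
  "trm e = (THE \<mu>. prob_space \<mu> \<and> sets \<mu> = sets (borel_of stream_topology) \<and>
    (\<forall>w. measure \<mu> (cylinder w) = word_prob e w))"


section \<open>Contraction operator interpretations\<close>

definition contractions :: "'m set \<Rightarrow> ('m \<Rightarrow> 'm \<Rightarrow> real) \<Rightarrow> ('m \<Rightarrow> 'm) set" where
  "contractions M d =
    {f \<in> M \<rightarrow> M. \<exists>c. 0 \<le> c \<and> c < 1 \<and> (\<forall>x\<in>M. \<forall>y\<in>M. d (f x) (f y) \<le> c * d x y)}"

definition stream_limit ::
    "'m set \<Rightarrow> ('m \<Rightarrow> 'm \<Rightarrow> real) \<Rightarrow> ('a \<Rightarrow> 'm \<Rightarrow> 'm) \<Rightarrow> 'a stream \<Rightarrow> 'm" where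
  "stream_limit M d \<sigma> s = (THE x. \<forall>p\<in>M.
    limitin (Metric_space.mtopology M d) (\<lambda>n. foldr \<sigma> (stake n s) p) x sequentially)"

definition delta_hat ::
    "'m set \<Rightarrow> ('m \<Rightarrow> 'm \<Rightarrow> real) \<Rightarrow> ('a \<Rightarrow> 'm \<Rightarrow> 'm) \<Rightarrow> 'a pterm \<Rightarrow> 'm measure" where
  "delta_hat M d \<sigma> e =
    distr (trm e) (borel_of (Metric_space.mtopology M d)) (stream_limit M d \<sigma>)"

text \<open>Agreement under all interpretations in nonempty complete metric spaces whose points
  belong to the type \<open>'m\<close>. Since HOL formulas do not quantify over types, the type is a
  parameter: equality of traces implies agreement for every type \<open>'m\<close>, and conversely
  agreement for the type \<^typ>\<open>real\<close> (with arbitrary carriers and metrics, so up to isometry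
  for all spaces with at most continuum many points) is enough to imply equality of traces.\<close>

definition same_interpretations :: "'m itself \<Rightarrow> 'a pterm \<Rightarrow> 'a pterm \<Rightarrow> bool" where
  "same_interpretations (_ :: 'm itself) e f \<longleftrightarrow>
    (\<forall>(M :: 'm set) d \<sigma>.
      Metric_space M d \<and> M \<noteq> {} \<and> Metric_space.mcomplete M d \<and>
      (\<forall>a. \<sigma> a \<in> contractions M d) \<longrightarrow>
      delta_hat M d \<sigma> e = delta_hat M d \<sigma> f)"

end

(* The interesting direction uses a single interpretation: the space of streams itself,
   with the prefix metric and with each action acting by prepending its letter. There the
   limit of a stream is that stream, so the interpretation of a term is its trace
   measure. The only requirement on the carrier is that streams inject into it.

   Since trace measures are given by a definite description, this needs that they exist. A trace
   measure is the law of the stream obtained by choosing, independently for each word w,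
   a letter that would follow w according to the conditional probabilities, and then
   reading off the letters that are chosen after the successive prefixes. *)

theory Submission
  imports Defs
begin

section \<open>Cylinders\<close>

lemma in_cylinder_iff: "s \<in> cylinder w \<longleftrightarrow> stake (length w) s = w"
  by (simp add: cylinder_def)

lemma in_cylinder_stake [simp]: "s \<in> cylinder (stake n s)"
  by (simp add: in_cylinder_iff)

lemma cylinder_Nil [simp]: "cylinder [] = UNIV"
  by (simp add: cylinder_def)

lemma in_cylinder_stake_iff: "t \<in> cylinder (stake n s) \<longleftrightarrow> stake n t = stake n s"
  by (simp add: in_cylinder_iff)

lemma stake_eq_mono: "stake n s = stake n t \<Longrightarrow> m \<le> n \<Longrightarrow> stake m s = stake m t"
  by (metis min.absorb1 take_stake)

lemma stream_eqI_snth: "(\<And>n. s !! n = t !! n) \<Longrightarrow> s = t"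
  using smap_alt[of id s t] by (simp add: stream.map_id)

lemma stream_eqI_stake: "(\<And>n. stake n s = stake n t) \<Longrightarrow> s = t"
  by (metis lessI stake_nth stream_eqI_snth)

lemma cylinder_stake_mono: "m \<le> n \<Longrightarrow> cylinder (stake n s) \<subseteq> cylinder (stake m s)"
  by (auto simp: in_cylinder_stake_iff dest: stake_eq_mono)

text \<open>If two cylinders share a stream, both words are prefixes of it, so one cylinder contains
  the other. Hence the cylinders together with the empty set are closed under intersection.\<close>

lemma cylinder_Int: "cylinder v \<inter> cylinder w \<in> {{}, cylinder v, cylinder w}"
proof (cases "cylinder v \<inter> cylinder w = {}")
  case False
  then obtain s where "s \<in> cylinder v" "s \<in> cylinder w"
    by blast
  then have vw: "v = stake (length v) s" "w = stake (length w) s"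
    by (simp_all add: in_cylinder_iff)
  have "cylinder w \<subseteq> cylinder v \<or> cylinder v \<subseteq> cylinder w"
    using cylinder_stake_mono[of "length v" "length w" s]
      cylinder_stake_mono[of "length w" "length v" s]
    by (simp flip: vw) linarith
  then show ?thesis
    by blast
qed simp

lemma Union_cylinders_eq:
  assumes "\<forall>s\<in>U. \<exists>n. cylinder (stake n s) \<subseteq> U"
  shows "(\<Union>w\<in>{w. cylinder w \<subseteq> U}. cylinder w) = U"
proof
  show "U \<subseteq> (\<Union>w\<in>{w. cylinder w \<subseteq> U}. cylinder w)"
  proof
    fix s assume "s \<in> U"
    with assms obtain n where "cylinder (stake n s) \<subseteq> U"
      by blast
    then show "s \<in> (\<Union>w\<in>{w. cylinder w \<subseteq> U}. cylinder w)"
      using in_cylinder_stake by blast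
  qed
qed blast

text \<open>The cylinders form a base and not only a subbase: around a given stream, the cylinder of
  the longer of two prefixes lies in both of their cylinders.\<close>

lemma openin_stream_topology_iff:
  "openin stream_topology U \<longleftrightarrow> (\<forall>s\<in>U. \<exists>n. cylinder (stake n s) \<subseteq> U)"
proof
  assume "openin stream_topology U"
  then have "generate_topology_on (range cylinder) U"
    by (simp add: stream_topology_def openin_topology_generated_by_iff)
  then show "\<forall>s\<in>U. \<exists>n. cylinder (stake n s) \<subseteq> U"
  proof induction
    case (Int V W)
    show ?case
    proof
      fix s assume "s \<in> V \<inter> W"
      with Int.IH obtain m n where "cylinder (stake m s) \<subseteq> V" "cylinder (stake n s) \<subseteq> W"
        by blast
      moreover have "cylinder (stake (max m n) s) \<subseteq> cylinder (stake m s) \<inter> cylinder (stake n s)"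
        by (simp add: cylinder_stake_mono)
      ultimately show "\<exists>n. cylinder (stake n s) \<subseteq> V \<inter> W"
        by blast
    qed
  next
    case (UN K)
    show ?case
    proof
      fix s assume "s \<in> \<Union>K"
      then obtain V where V: "V \<in> K" "s \<in> V" by blast
      with UN.IH obtain n where "cylinder (stake n s) \<subseteq> V" by metis
      with V(1) show "\<exists>n. cylinder (stake n s) \<subseteq> \<Union>K" by blast
    qed
  next
    case (Basis V)
    then show ?case
      by (metis imageE in_cylinder_iff subset_refl)
  qed simp
next
  assume U: "\<forall>s\<in>U. \<exists>n. cylinder (stake n s) \<subseteq> U"
  have "openin stream_topology (\<Union>w\<in>{w. cylinder w \<subseteq> U}. cylinder w)"
    by (intro openin_Union) (auto simp: stream_topology_def intro: topology_generated_by_Basis)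
  then show "openin stream_topology U"
    by (simp add: Union_cylinders_eq[OF U])
qed

lemma topspace_stream_topology [simp]: "topspace stream_topology = UNIV"
  unfolding stream_topology_def topology_generated_by_topspace using cylinder_Nil by blast

section \<open>Borel sets of the stream space and uniqueness of measures on it\<close>

lemma sets_borel_of: "sets (borel_of X) = sigma_sets (topspace X) {U. openin X U}"
  unfolding borel_of_def by (rule sets_measure_of) (auto dest: openin_subset)

lemma space_borel_of [simp]: "space (borel_of X) = topspace X"
  unfolding borel_of_def by (rule space_measure_of) (auto dest: openin_subset)

lemma borel_of_open: "openin X U \<Longrightarrow> U \<in> sets (borel_of X)"
  by (simp add: sets_borel_of)

text \<open>Over a countable alphabet there are only countably many words, so every open set is a
  countable union of cylinders.\<close>

lemma sets_borel_of_stream_topology: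
  "sets (borel_of (stream_topology :: 'a::countable stream topology)) =
    sigma_sets UNIV (range cylinder)"
proof -
  have "U \<in> sigma_sets UNIV (range cylinder)"
    if "openin stream_topology U" for U :: "'a stream set"
  proof -
    interpret sigma_algebra UNIV "sigma_sets UNIV (range cylinder :: 'a stream set set)"
      by (rule sigma_algebra_sigma_sets) simp
    have "(\<Union>w\<in>{w. cylinder w \<subseteq> U}. cylinder w) \<in> sigma_sets UNIV (range cylinder)"
      by (intro countable_UN') auto
    then show ?thesis
      using that by (simp add: Union_cylinders_eq openin_stream_topology_iff)
  qed
  moreover have "openin stream_topology (cylinder w)" for w :: "'a list"
    by (simp add: stream_topology_def topology_generated_by_Basis)
  ultimately show ?thesis
    unfolding sets_borel_of topspace_stream_topology
    by (intro sigma_sets_eqI) auto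
qed

lemma cylinder_in_sets: "cylinder w \<in> sets (borel_of stream_topology)"
  by (intro borel_of_open) (simp add: stream_topology_def topology_generated_by_Basis)

lemma prob_space_eqI_cylinder:
  fixes \<mu> \<nu> :: "'a::countable stream measure"
  assumes "prob_space \<mu>" "prob_space \<nu>"
    and sets: "sets \<mu> = sets (borel_of stream_topology)" "sets \<nu> = sets (borel_of stream_topology)"
    and eq: "\<And>w. measure \<mu> (cylinder w) = measure \<nu> (cylinder w)"
  shows "\<mu> = \<nu>"
proof -
  interpret \<mu>: prob_space \<mu> by fact
  interpret \<nu>: prob_space \<nu> by fact
  let ?E = "insert {} (range cylinder) :: 'a stream set set"
  have gen: "sigma_sets UNIV (range cylinder) = sigma_sets UNIV ?E"
    by (intro sigma_sets_eqI) (auto intro: sigma_sets.Empty)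
  show ?thesis
  \<comment> \<open>The whole space is the cylinder of the empty word, so the constant sequence
    \<open>UNIV\<close> is an exhaustion by generators of finite measure.\<close>
  proof (rule measure_eqI_generator_eq[where \<Omega> = UNIV and E = ?E and A = "\<lambda>_. UNIV"])
    show "Int_stable ?E"
    proof (rule Int_stableI)
      fix a b assume "a \<in> ?E" "b \<in> ?E"
      then consider "a \<inter> b = {}" | v w where "a = cylinder v" "b = cylinder w"
        by blast
      then show "a \<inter> b \<in> ?E"
      proof cases
        case (2 v w)
        then show ?thesis
          using cylinder_Int[of v w] by auto
      qed simp
    qed
    show "emeasure \<mu> X = emeasure \<nu> X" if "X \<in> ?E" for X
      using that eq by (auto simp: \<mu>.emeasure_eq_measure \<nu>.emeasure_eq_measure)
    show "range (\<lambda>_. UNIV) \<subseteq> ?E"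
      using cylinder_Nil by blast
  qed (simp_all add: sets sets_borel_of_stream_topology gen)
qed


section \<open>Measures with prescribed cylinder probabilities\<close>

primrec chosen_word :: "('a list \<Rightarrow> 'a) \<Rightarrow> nat \<Rightarrow> 'a list" where
  "chosen_word F 0 = []"
| "chosen_word F (Suc n) = chosen_word F n @ [F (chosen_word F n)]"

definition chosen_stream :: "('a list \<Rightarrow> 'a) \<Rightarrow> 'a stream" where
  "chosen_stream F = smap (\<lambda>n. F (chosen_word F n)) nats"

lemma stake_chosen_stream: "stake n (chosen_stream F) = chosen_word F n"
  by (induction n) (simp_all add: stake_Suc chosen_stream_def del: stake.simps(2))

text \<open>The preimage of a cylinder constrains \<open>F\<close> only at the finitely many proper
  prefixes of \<open>w\<close>, so a product measure can evaluate it.\<close>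

lemma chosen_stream_in_cylinder_iff:
  "chosen_stream F \<in> cylinder w \<longleftrightarrow> (\<forall>i<length w. F (take i w) = w ! i)"
proof -
  have "chosen_word F n = take n w \<longleftrightarrow> (\<forall>i<n. F (take i w) = w ! i)" if "n \<le> length w" for n
    using that by (induction n) (auto simp: take_Suc_conv_app_nth All_less_Suc)
  from this[of "length w"] show ?thesis
    by (simp add: in_cylinder_iff stake_chosen_stream)
qed

text \<open>Normalise by the total; if the total is 0, then every \<open>q a\<close> is 0 and any
  distribution serves. The product form of the equation avoids a division by zero.\<close>

lemma one_step_pmf_exists:
  fixes q :: "'a::finite \<Rightarrow> real"
  assumes "\<And>a. 0 \<le> q a"
  shows "\<exists>K. \<forall>a. sum q UNIV * pmf K a = q a"
proof (cases "sum q UNIV = 0")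
  case True
  with assms have "q a = 0" for a
    by (simp add: sum_nonneg_eq_0_iff)
  with True show ?thesis by simp
next
  case False
  let ?k = "\<lambda>a. q a / sum q UNIV"
  have nonneg: "0 \<le> ?k a" for a
    using assms by (simp add: sum_nonneg)
  moreover have "(\<integral>\<^sup>+a. ?k a \<partial>count_space UNIV) = 1"
    using False nonneg
    by (simp add: nn_integral_count_space_finite sum_ennreal flip: sum_divide_distrib)
  ultimately have "pmf (embed_pmf ?k) a = ?k a" for a
    by (rule pmf_embed_pmf)
  with False show ?thesis
    by (intro exI[of _ "embed_pmf ?k"]) simp
qed

text \<open>The last hypothesis is Kolmogorov consistency. The existence of arbitrary products of
  probability spaces takes the place of an extension argument for cylinders.\<close>

lemma stream_measure_exists:
  fixes p :: "'a::finite list \<Rightarrow> real"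
  assumes nonneg: "\<And>w. 0 \<le> p w" and Nil: "p [] = 1"
    and snoc: "\<And>w. (\<Sum>a\<in>UNIV. p (w @ [a])) = p w"
  shows "\<exists>\<mu>. prob_space \<mu> \<and> sets \<mu> = sets (borel_of stream_topology) \<and>
    (\<forall>w. measure \<mu> (cylinder w) = p w)"
proof -
  \<comment> \<open>The conditional law of the letter after \<open>w\<close>; it is arbitrary where
    \<open>p w = 0\<close>.\<close>
  have "\<exists>K. \<forall>a. p w * pmf K a = p (w @ [a])" for w
    using one_step_pmf_exists[of "\<lambda>a. p (w @ [a])"] nonneg snoc by simp
  then obtain K where K: "p w * pmf (K w) a = p (w @ [a])" for w a
    by metis
  \<comment> \<open>Chain rule: the conditional probabilities multiply along the prefixes of
    \<open>w\<close>.\<close>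
  have p_eq: "p w = (\<Prod>i<length w. pmf (K (take i w)) (w ! i))" for w
  proof (induction w rule: rev_induct)
    case (snoc a w)
    then show ?case
      by (simp add: K[symmetric] nth_append)
  qed (simp add: Nil)
  interpret product_prob_space "\<lambda>w. measure_pmf (K w)" UNIV
    by standard
  let ?P = "\<Pi>\<^sub>M w\<in>UNIV. measure_pmf (K w)"
  have space: "space ?P = UNIV"
    by (simp add: space_PiM)
  \<comment> \<open>The coordinates are indexed by the prefixes themselves. A prefix
    \<open>v\<close> of length \<open>i\<close> must be followed by \<open>w ! i\<close>, which is
    \<open>w ! length v\<close>.\<close>
  have vimage: "chosen_stream -` cylinder w \<inter> space ?P =
      prod_emb UNIV (\<lambda>w. measure_pmf (K w)) ((\<lambda>i. take i w) ` {..<length w})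
        (\<Pi>\<^sub>E v\<in>(\<lambda>i. take i w) ` {..<length w}. {w ! length v})" for w
    by (auto simp: chosen_stream_in_cylinder_iff prod_emb_def space PiE_iff)
  have meas: "chosen_stream \<in> measurable ?P (borel_of stream_topology)"
  proof (rule measurable_sigma_sets[OF sets_borel_of_stream_topology])
    fix A :: "'a stream set" assume "A \<in> range cylinder"
    then obtain w where w: "A = cylinder w" by blast
    show "chosen_stream -` A \<inter> space ?P \<in> sets ?P"
      unfolding w vimage by (rule sets_PiM_I) auto
  qed auto
  have "measure (distr ?P (borel_of stream_topology) chosen_stream) (cylinder w) = p w" for w
  proof -
    have "emeasure (distr ?P (borel_of stream_topology) chosen_stream) (cylinder w) =
        (\<Prod>v\<in>(\<lambda>i. take i w) ` {..<length w}. emeasure (measure_pmf (K v)) {w ! length v})"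
      by (subst emeasure_distr[OF meas cylinder_in_sets], subst vimage, rule emeasure_PiM_emb)
        auto
    \<comment> \<open>Prefixes of different lengths are different words, so the product can be
      indexed by length.\<close>
    also have "\<dots> = (\<Prod>i<length w. ennreal (pmf (K (take i w)) (w ! i)))"
      by (subst prod.reindex)
        (auto simp: inj_on_def emeasure_pmf_single dest: arg_cong[where f = length])
    also have "\<dots> = ennreal (p w)"
      by (simp add: p_eq prod_ennreal)
    finally show ?thesis
      using nonneg by (simp add: measure_def)
  qed
  moreover have "prob_space (distr ?P (borel_of stream_topology) chosen_stream)"
    by (rule P.prob_space_distr[OF meas])
  ultimately show ?thesis
    by (metis sets_distr)
qed


section \<open>Trace measures\<close>

lemma path_weight_Cons:
  "path_weight e (a # w) (e' # es) = pmf (delta e) (a, e') * path_weight e' w es"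
  by (simp add: path_weight_def prod.lessThan_Suc_shift del: prod.lessThan_Suc)

lemma word_prob_nonneg: "0 \<le> word_prob e w"
  by (auto simp: word_prob_def path_weight_def intro!: sum_nonneg prod_nonneg)

lemma word_prob_Nil [simp]: "word_prob e [] = 1"
  by (simp add: word_prob_def path_weight_def)

text \<open>A path is a first transition followed by a path from its target, and only targets in the
  finite support of \<open>delta e\<close> count.\<close>

lemma word_prob_Cons:
  assumes "e \<in> PTerm"
  shows "word_prob e (a # w) =
    (\<Sum>e'\<in>snd ` set_pmf (delta e). pmf (delta e) (a, e') * word_prob e' w)"
proof -
  \<comment> \<open>Targets are collected over all labels, so that the index set does not depend on
    \<open>a\<close>; those not reached by \<open>a\<close> contribute 0.\<close>
  let ?S = "snd ` set_pmf (delta e)"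
  define paths where "paths e' = {es. length es = length w \<and> path_weight e' w es \<noteq> 0}" for e'
  have S: "finite ?S" "?S \<subseteq> PTerm"
    using delta_PTerm[OF assms] by auto
  then have fin: "finite (Sigma ?S paths)"
    unfolding paths_def by (intro finite_SigmaI finite_paths) auto
  have "word_prob e (a # w) = (\<Sum>es\<in>(\<lambda>(e', es). e' # es) ` Sigma ?S paths. path_weight e (a # w) es)"
    unfolding word_prob_def
  proof (rule sum.mono_neutral_left)
    show "{es. length es = length (a # w) \<and> path_weight e (a # w) es \<noteq> 0}
      \<subseteq> (\<lambda>(e', es). e' # es) ` Sigma ?S paths"
      by (force simp: length_Suc_conv path_weight_Cons set_pmf_iff paths_def)
  qed (use fin in \<open>auto simp: paths_def\<close>)
  also have "\<dots> = (\<Sum>(e', es)\<in>Sigma ?S paths. path_weight e (a # w) (e' # es))"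
    by (subst sum.reindex) (auto simp: inj_on_def case_prod_beta')
  also have "\<dots> = (\<Sum>e'\<in>?S. \<Sum>es\<in>paths e'. path_weight e (a # w) (e' # es))"
    using S by (subst sum.Sigma) (auto simp: paths_def intro: finite_paths)
  also have "\<dots> = (\<Sum>e'\<in>?S. pmf (delta e) (a, e') * word_prob e' w)"
    by (simp add: path_weight_Cons word_prob_def paths_def sum_distrib_left)
  finally show ?thesis .
qed

text \<open>The consistency condition for the existence of the trace measure. The induction varies
  \<open>e\<close>, since the first letter leads to other terms.\<close>

lemma sum_word_prob_snoc:
  fixes e :: "'a::finite pterm"
  assumes "e \<in> PTerm"
  shows "(\<Sum>a\<in>UNIV. word_prob e (w @ [a])) = word_prob e w"
  using assms
proof (induction w arbitrary: e)
  case Nil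
  let ?S = "snd ` set_pmf (delta e)"
  \<comment> \<open>All letters paired with all targets cover the support of \<open>delta e\<close>,
    so the total mass is 1.\<close>
  have "(\<Sum>a\<in>UNIV. word_prob e ([] @ [a])) = (\<Sum>x\<in>UNIV \<times> ?S. pmf (delta e) x)"
    by (simp add: word_prob_Cons[OF Nil] sum.cartesian_product)
  also have "\<dots> = 1"
    using delta_PTerm[OF Nil] by (intro sum_pmf_eq_1) force+
  finally show ?case by simp
next
  case (Cons b w)
  have "(\<Sum>a\<in>UNIV. word_prob e ((b # w) @ [a])) =
      (\<Sum>e'\<in>snd ` set_pmf (delta e). pmf (delta e) (b, e') * (\<Sum>a\<in>UNIV. word_prob e' (w @ [a])))"
    by (simp add: word_prob_Cons[OF Cons.prems] sum_distrib_left sum.swap[of _ UNIV])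
  also have "\<dots> = word_prob e (b # w)"
    using delta_PTerm[OF Cons.prems]
    by (auto simp: word_prob_Cons[OF Cons.prems] intro!: sum.cong Cons.IH)
  finally show ?case .
qed

text \<open>Existence comes from the random choice of letters, uniqueness from agreement on
  cylinders; together they justify the definite description.\<close>

lemma trm_PTerm:
  fixes e :: "'a::finite pterm"
  assumes "e \<in> PTerm"
  shows "prob_space (trm e)" "sets (trm e) = sets (borel_of stream_topology)"
    "measure (trm e) (cylinder w) = word_prob e w"
proof -
  have "\<exists>!\<mu>. prob_space \<mu> \<and> sets \<mu> = sets (borel_of stream_topology) \<and>
    (\<forall>w. measure \<mu> (cylinder w) = word_prob e w)"
    using stream_measure_exists[of "word_prob e"] sum_word_prob_snoc[OF assms] word_prob_nonneg
    by (intro ex_ex1I) (auto intro: prob_space_eqI_cylinder)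
  from theI'[OF this]
  show "prob_space (trm e)" "sets (trm e) = sets (borel_of stream_topology)"
    "measure (trm e) (cylinder w) = word_prob e w"
    unfolding trm_def by blast+
qed


section \<open>The prefix metric\<close>

definition prefix_dist :: "'a stream \<Rightarrow> 'a stream \<Rightarrow> real" where
  "prefix_dist s t = (if s = t then 0 else (1/2) ^ (LEAST n. s !! n \<noteq> t !! n))"

lemma prefix_dist_self [simp]: "prefix_dist s s = 0"
  by (simp add: prefix_dist_def)

text \<open>For distinct streams that first differ at index \<open>k\<close>, both sides say
  \<open>n \<le> k\<close>. This translates metric statements into statements about
  prefixes.\<close>

lemma prefix_dist_le_iff: "prefix_dist s t \<le> (1/2) ^ n \<longleftrightarrow> stake n s = stake n t"
proof (cases "s = t")
  case False
  define k where "k = (LEAST n. s !! n \<noteq> t !! n)"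
  have "\<exists>n. s !! n \<noteq> t !! n"
    using False stream_eqI_snth by blast
  then have k: "s !! k \<noteq> t !! k"
    unfolding k_def by (rule LeastI_ex)
  have below: "s !! i = t !! i" if "i < k" for i
    using not_less_Least[of i "\<lambda>n. s !! n \<noteq> t !! n"] that by (auto simp: k_def)
  have "stake n s = stake n t \<longleftrightarrow> (\<forall>i<n. s !! i = t !! i)"
    by (simp add: list_eq_iff_nth_eq)
  also have "\<dots> \<longleftrightarrow> n \<le> k"
    using k below by (metis less_le_trans not_le)
  finally show ?thesis
    using False by (simp add: prefix_dist_def flip: k_def)
qed (simp add: prefix_dist_def)

lemma prefix_dist_cases:
  obtains "s = t" "prefix_dist s t = 0" | n where "prefix_dist s t = (1/2) ^ n"
  by (metis prefix_dist_def)

lemma prefix_dist_nonneg [simp]: "0 \<le> prefix_dist s t"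
  by (simp add: prefix_dist_def)

lemma prefix_dist_eq_0_iff [simp]: "prefix_dist s t = 0 \<longleftrightarrow> s = t"
  by (simp add: prefix_dist_def)

lemma prefix_dist_commute: "prefix_dist s t = prefix_dist t s"
  by (simp add: prefix_dist_def eq_commute)

text \<open>The larger distance is 0 or some power \<open>(1/2) ^ n\<close>. In the latter case all
  three streams share their first \<open>n\<close> letters.\<close>

lemma prefix_dist_ultrametric: "prefix_dist s u \<le> max (prefix_dist s t) (prefix_dist t u)"
proof -
  define r where "r = max (prefix_dist s t) (prefix_dist t u)"
  then have "r = prefix_dist s t \<or> r = prefix_dist t u"
    by (simp add: max_def)
  then consider "r = 0" | n where "r = (1/2) ^ n"
    by (metis prefix_dist_cases)
  then show ?thesis
  proof cases
    case 1
    have "prefix_dist s t \<le> r" "prefix_dist t u \<le> r"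
      by (simp_all add: r_def)
    with 1 have "prefix_dist s t = 0" "prefix_dist t u = 0"
      using prefix_dist_nonneg by (metis order_antisym)+
    then show ?thesis by simp
  next
    case (2 n)
    have "prefix_dist s t \<le> r" "prefix_dist t u \<le> r"
      by (simp_all add: r_def)
    with 2 have "prefix_dist s u \<le> (1/2) ^ n"
      by (simp add: prefix_dist_le_iff)
    with 2 show ?thesis
      by (simp add: r_def)
  qed
qed

lemma prefix_dist_triangle: "prefix_dist s u \<le> prefix_dist s t + prefix_dist t u"
  using prefix_dist_ultrametric[of s u t] prefix_dist_nonneg[of s t] prefix_dist_nonneg[of t u]
  by linarith

text \<open>Prepending a letter lengthens the common prefix by one.\<close>

lemma prefix_dist_SCons_le: "prefix_dist (a ## s) (a ## t) \<le> 1/2 * prefix_dist s t"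
proof (cases rule: prefix_dist_cases[of s t])
  case (2 n)
  then have "stake n s = stake n t"
    by (simp flip: prefix_dist_le_iff)
  then have "stake (Suc n) (a ## s) = stake (Suc n) (a ## t)"
    by simp
  then show ?thesis
    using 2 by (simp only: flip: prefix_dist_le_iff) simp
qed simp

lemma half_power_less_exists: "0 < r \<Longrightarrow> \<exists>n. (1/2 :: real) ^ n < r"
  by (simp add: real_arch_pow_inv)


section \<open>Streams as an interpretation\<close>

text \<open>A stream is determined by the set of codes of its prefixes, and sets of naturals inject
  into the reals.\<close>

lemma inj_stream_real_exists: "\<exists>c :: 'a::countable stream \<Rightarrow> real. inj c"
proof -
  obtain h :: "nat set \<Rightarrow> real" where h: "inj h"
    using eqpoll_imp_lepoll[OF nat_sets_eqpoll_reals] by (auto simp: lepoll_def)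
  have "inj (\<lambda>s :: 'a stream. to_nat ` range (\<lambda>n. stake n s))"
  proof (rule injI)
    fix s t :: "'a stream"
    assume "to_nat ` range (\<lambda>n. stake n s) = to_nat ` range (\<lambda>n. stake n t)"
    then have eq: "range (\<lambda>n. stake n s) = range (\<lambda>n. stake n t)"
      by (simp add: inj_image_eq_iff)
    show "s = t"
    proof (rule stream_eqI_stake)
      fix n
      \<comment> \<open>A set of prefixes of one stream has exactly one member of each
        length.\<close>
      have "stake n s \<in> range (\<lambda>n. stake n t)"
        unfolding eq[symmetric] by blast
      then show "stake n s = stake n t"
        by (metis imageE length_stake)
    qed
  qed
  from inj_compose[OF h this] show ?thesis
    by blast
qed

text \<open>Interpretations range over spaces with points in a given type; along \<open>c\<close>
  the stream space is transported to the subset \<open>range c\<close> of that type.\<close>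

locale stream_coding =
  fixes c :: "'a stream \<Rightarrow> 'm"
  assumes inj: "inj c"
begin

definition dist_c :: "'m \<Rightarrow> 'm \<Rightarrow> real" where
  "dist_c x y = prefix_dist (inv c x) (inv c y)"

definition prepend :: "'a \<Rightarrow> 'm \<Rightarrow> 'm" where
  "prepend a x = c (a ## inv c x)"

lemma inv_c [simp]: "inv c (c s) = s"
  using inj by simp

lemma dist_c_code [simp]: "dist_c (c s) (c t) = prefix_dist s t"
  by (simp add: dist_c_def)

sublocale Metric_space "range c" dist_c
proof
  show "dist_c x y = 0 \<longleftrightarrow> x = y" if "x \<in> range c" "y \<in> range c" for x y
    using that inj by (auto simp: inj_eq)
qed (auto simp: dist_c_def prefix_dist_commute prefix_dist_triangle)

text \<open>In a Cauchy sequence the first \<open>k\<close> letters are eventually constant, for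
  each \<open>k\<close>; the eventual letters form the limit.\<close>

lemma mcomplete: mcomplete
  unfolding mcomplete_def
proof (intro allI impI)
  fix \<sigma> assume Cauchy: "MCauchy \<sigma>"
  define t where "t n = inv c (\<sigma> n)" for n
  have \<sigma>: "\<sigma> n = c (t n)" for n
    using Cauchy unfolding MCauchy_def t_def by (metis f_inv_into_f range_subsetD)
  have "\<exists>N. \<forall>m\<ge>N. \<forall>n\<ge>N. stake k (t m) = stake k (t n)" for k
  proof -
    obtain N where "\<And>m n. N \<le> m \<Longrightarrow> N \<le> n \<Longrightarrow> dist_c (\<sigma> m) (\<sigma> n) < (1/2) ^ k"
      using Cauchy unfolding MCauchy_def
      by (meson zero_less_divide_1_iff zero_less_numeral zero_less_power)
    then show ?thesis
      by (force simp: \<sigma> simp flip: prefix_dist_le_iff intro: less_imp_le)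
  qed
  then obtain N where N: "\<And>k m n. N k \<le> m \<Longrightarrow> N k \<le> n \<Longrightarrow> stake k (t m) = stake k (t n)"
    by metis
  \<comment> \<open>The letter at index \<open>k\<close> is read off once the prefix of length
    \<open>Suc k\<close> is stable.\<close>
  define s where "s = smap (\<lambda>k. t (N (Suc k)) !! k) nats"
  have s: "stake k s = stake k (t n)" if "N k \<le> n" for k n
  proof -
    have "t (N (Suc i)) !! i = t n !! i" if "i < k" for i
    proof -
      \<comment> \<open>An index beyond both thresholds links the two streams.\<close>
      let ?m = "max n (N (Suc i))"
      have "t (N (Suc i)) !! i = t ?m !! i"
        using N[of "Suc i" "N (Suc i)" ?m] by (metis lessI max.cobounded2 order_refl stake_nth)
      also have "\<dots> = t n !! i"
        using N[of k ?m n] \<open>N k \<le> n\<close> \<open>i < k\<close> by (metis max.coboundedI1 stake_nth)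
      finally show ?thesis .
    qed
    then show ?thesis
      by (simp add: list_eq_iff_nth_eq s_def)
  qed
  have "limitin mtopology \<sigma> (c s) sequentially"
    unfolding limit_metric_sequentially
  proof (intro conjI allI impI)
    fix \<epsilon> :: real assume "0 < \<epsilon>"
    then obtain k where k: "(1/2) ^ k < \<epsilon>"
      using half_power_less_exists by blast
    have "dist_c (\<sigma> n) (c s) < \<epsilon>" if "N k \<le> n" for n
    proof -
      have "prefix_dist (t n) s \<le> (1/2) ^ k"
        using s[OF that] by (simp add: prefix_dist_le_iff)
      with k show ?thesis by (simp add: \<sigma>)
    qed
    then show "\<exists>N. \<forall>n\<ge>N. \<sigma> n \<in> range c \<and> dist_c (\<sigma> n) (c s) < \<epsilon>"
      by (auto simp: \<sigma>)
  qed simp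
  then show "\<exists>x. limitin mtopology \<sigma> x sequentially" ..
qed

lemma prepend_contraction: "prepend a \<in> contractions (range c) dist_c"
proof -
  have "\<forall>x\<in>range c. \<forall>y\<in>range c. dist_c (prepend a x) (prepend a y) \<le> 1/2 * dist_c x y"
    using prefix_dist_SCons_le by (auto simp: prepend_def)
  then show ?thesis
    unfolding contractions_def by (force simp: prepend_def intro: exI[of _ "1/2"])
qed

lemma foldr_prepend: "foldr prepend w (c t) = c (w @- t)"
  by (induction w) (simp_all add: prepend_def)

text \<open>After \<open>n\<close> letters the approximant agrees with \<open>s\<close> on its first
  \<open>n\<close> letters, whatever the starting point.\<close>

lemma limitin_prepend:
  assumes "p \<in> range c"
  shows "limitin mtopology (\<lambda>n. foldr prepend (stake n s) p) (c s) sequentially"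
  unfolding limit_metric_sequentially
proof (intro conjI allI impI)
  obtain t where p: "p = c t"
    using assms by blast
  fix \<epsilon> :: real assume "0 < \<epsilon>"
  then obtain k where k: "(1/2) ^ k < \<epsilon>"
    using half_power_less_exists by blast
  have "prefix_dist (stake n s @- t) s < \<epsilon>" if "k \<le> n" for n
  proof -
    have "stake k (stake n s @- t) = stake k s"
      using that by (simp add: stake_shift take_stake min_absorb1)
    with k show ?thesis
      by (meson order_le_less_trans prefix_dist_le_iff)
  qed
  then show "\<exists>N. \<forall>n\<ge>N. foldr prepend (stake n s) p \<in> range c \<and>
      dist_c (foldr prepend (stake n s) p) (c s) < \<epsilon>"
    by (auto simp: p foldr_prepend)
qed simp

lemma stream_limit_prepend: "stream_limit (range c) dist_c prepend = c"
proof
  fix s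
  show "stream_limit (range c) dist_c prepend s = c s"
    unfolding stream_limit_def
  proof (rule the_equality)
    show "\<forall>p\<in>range c. limitin mtopology (\<lambda>n. foldr prepend (stake n s) p) (c s) sequentially"
      using limitin_prepend by blast
    \<comment> \<open>The carrier point \<open>c s\<close> serves as a starting point; limits in a
      metric space are unique.\<close>
    show "x = c s" if "\<forall>p\<in>range c. limitin mtopology (\<lambda>n. foldr prepend (stake n s) p) x sequentially"
      for x
      using that limitin_prepend[of "c s"] limitin_metric_unique trivial_limit_sequentially
      by blast
  qed
qed

section \<open>The coding as a continuous and measurable map\<close>

lemma openin_vimage_code:
  assumes "openin mtopology U"
  shows "openin stream_topology (c -` U)"
  unfolding openin_stream_topology_iff
proof
  fix s assume "s \<in> c -` U"
  with assms obtain r where r: "0 < r" "mball (c s) r \<subseteq> U"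
    by (auto simp: openin_mtopology)
  obtain n where n: "(1/2) ^ n < r"
    using half_power_less_exists[OF r(1)] by blast
  have "c t \<in> mball (c s) r" if "t \<in> cylinder (stake n s)" for t
  proof -
    have "prefix_dist s t \<le> (1/2) ^ n"
      using that by (simp add: prefix_dist_le_iff in_cylinder_stake_iff)
    with n show ?thesis by simp
  qed
  with r(2) show "\<exists>n. cylinder (stake n s) \<subseteq> c -` U"
    by blast
qed

text \<open>Every point of the image has a ball of radius \<open>(1/2) ^ length w\<close> inside it,
  since that distance fixes the first \<open>length w\<close> letters.\<close>

lemma openin_code_cylinder: "openin mtopology (c ` cylinder w)"
  unfolding openin_mtopology
proof (intro conjI allI impI)
  fix x assume "x \<in> c ` cylinder w"
  then obtain s where s: "x = c s" "s \<in> cylinder w" by blast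
  have "mball x ((1/2) ^ length w) \<subseteq> c ` cylinder w"
  proof
    fix y assume "y \<in> mball x ((1/2) ^ length w)"
    then obtain t where "y = c t" "prefix_dist s t \<le> (1/2) ^ length w"
      using s by auto
    with s show "y \<in> c ` cylinder w"
      by (auto simp: prefix_dist_le_iff in_cylinder_iff)
  qed
  then show "\<exists>r>0. mball x r \<subseteq> c ` cylinder w"
    by (intro exI[of _ "(1/2) ^ length w"]) simp
qed auto

lemma measurable_code: "c \<in> measurable (borel_of stream_topology) (borel_of mtopology)"
proof (rule measurable_sigma_sets[OF sets_borel_of])
  show "c -` U \<inter> space (borel_of stream_topology) \<in> sets (borel_of stream_topology)"
    if "U \<in> {U. openin mtopology U}" for U
    using that openin_vimage_code by (simp add: borel_of_open)
qed (use openin_subset in fastforce)+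

text \<open>The interpretation is the pushforward along \<open>c\<close>, and by injectivity the
  preimage of a coded cylinder is the cylinder itself, so no cylinder probability is lost.\<close>

lemma measure_delta_hat:
  assumes "sets (trm e) = sets (borel_of stream_topology)"
  shows "measure (delta_hat (range c) dist_c prepend e) (c ` cylinder w) =
    measure (trm e) (cylinder w)"
proof -
  have "c \<in> measurable (trm e) (borel_of mtopology)"
    using measurable_code measurable_cong_sets[OF assms refl] by blast
  then have "measure (delta_hat (range c) dist_c prepend e) (c ` cylinder w) =
      measure (trm e) (c -` c ` cylinder w \<inter> space (trm e))"
    unfolding delta_hat_def stream_limit_prepend
    by (rule measure_distr) (intro borel_of_open openin_code_cylinder)
  also have "c -` c ` cylinder w \<inter> space (trm e) = cylinder w"
    using inj sets_eq_imp_space_eq[OF assms] by (simp add: inj_vimage_image_eq)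
  finally show ?thesis .
qed

end

lemma trm_eqI:
  fixes e f :: "'a::finite pterm" and c :: "'a stream \<Rightarrow> 'm"
  assumes "inj c" "e \<in> PTerm" "f \<in> PTerm" "same_interpretations TYPE('m) e f"
  shows "trm e = trm f"
proof (rule prob_space_eqI_cylinder)
  interpret stream_coding c
    by unfold_locales fact
  have "delta_hat (range c) dist_c prepend e = delta_hat (range c) dist_c prepend f"
    using assms(4) Metric_space_axioms mcomplete prepend_contraction
    unfolding same_interpretations_def by blast
  then show "measure (trm e) (cylinder w) = measure (trm f) (cylinder w)" for w
    using measure_delta_hat trm_PTerm(2) assms(2,3) by metis
qed (use assms trm_PTerm in auto)

theorem mainTheorem10:
  fixes e f :: "'a::finite pterm"
  assumes "e \<in> PTerm" and "f \<in> PTerm"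
  shows "(trm e = trm f \<longrightarrow> same_interpretations TYPE('m) e f) \<and>
         (same_interpretations TYPE(real) e f \<longrightarrow> trm e = trm f)"
proof (intro conjI impI)
  assume "trm e = trm f"
  \<comment> \<open>\<open>delta_hat\<close> depends on the term only through its trace
    measure.\<close>
  then show "same_interpretations TYPE('m) e f"
    by (simp add: same_interpretations_def delta_hat_def)
next
  assume same: "same_interpretations TYPE(real) e f"
  \<comment> \<open>A finite alphabet is countable, so its streams fit into the reals.\<close>
  obtain c :: "'a stream \<Rightarrow> real" where "inj c"
    using inj_stream_real_exists by blast
  then show "trm e = trm f"
    using assms same by (rule trm_eqI)
qed

end
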